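(* Let $p=2$, $\mu_1\in\mathcal P_{ac}(\Omega)$, $\mu_2\in\mathcal P(\Omega)$ and $t\in[0,1]$. Let $\bar\nu=\big((1-t)\,\mathrm{id}+tS\big)_{\#}\mu_1$ be the solution of $$\mathrm{wC}(\mu_1,\mu_2)=\inf_{\nu\in\mathcal P(\Omega)}t\,\mathcal T_2(\mu_2|\nu)+(1-t)\,\mathcal T_2(\nu|\mu_1),$$ where $S$ is the $2$-Wasserstein optimal map from $\mu_1$ to the unique minimizer of $\inf_{\eta_2\le_{cx}\mu_2}\mathrm{CMM}(\mu_1,\eta_2)$. Let $\bar\eta_2$ be the unique minimizer of $\inf_{\eta_2\le_{cx}\mu_2}W_2^2(\mu_1,\eta_2)$ and let $\nabla\bar\varphi$ be the $2$-Wasserstein optimal map from $\mu_1$ to $\bar\eta_2$. Then $\bar\nu$ is the law of $Y_t$, where the process $(Y_s)_{s\in[0,1]}$ fulfills $Y_0\sim\mu_1$, $Y_1\sim\bar\eta_2$ and $dY_s=(\nabla\bar\varphi(Y_0)-Y_0)\,ds$.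
   Context: $\Omega\subset\mathbb R^d$ is a fixed compact convex set, $\mathcal P(\Omega)$ is the set of Borel probability measures on $\Omega$, and $\mathcal P_{ac}(\Omega)$ is the subset of those absolutely continuous with respect to Lebesgue measure. For $\mu,\nu\in\mathcal P(\Omega)$, $\Pi(\mu,\nu)$ is the set of couplings of $\mu$ and $\nu$ (first marginal $\mu$, second marginal $\nu$), and $W_2(\mu,\nu)^2=\inf_{\gamma\in\Pi(\mu,\nu)}\int_{\Omega^2}|x-y|^2\,d\gamma(x,y)$. A $2$-Wasserstein optimal map from $\mu$ to $\nu$ is a map $T$ such that $(\mathrm{id}\times T)_\#\mu$ minimizes $W_2^2(\mu,\nu)$; $\#$ denotes pushforward. The weak optimal transport cost with barycentric cost is $$\mathcal T_2(\nu|\mu)=\inf_{\gamma\in\Pi(\mu,\nu)}\int_\Omega\Big|x-\int_\Omega y\,d\gamma_x(y)\Big|^2\,d\mu(x),$$ where $d\gamma(x,y)=d\gamma_x(y)\,d\mu(x)$ is the disintegration with respect to the first marginal. Convex order: for $\eta,\mu\in\mathcal P(\Omega)$, $\eta\le_{cx}\mu$ means $\int_\Omega\varphi\,d\eta\le\int_\Omega\varphi\,d\mu$ for all convex $\varphi:\mathbb R^d\to\mathbb R$. For $\mu_1,\eta_2\in\mathcal P(\Omega)$, $\mathrm{CMM}(\mu_1,\eta_2)=\inf_{\gamma\in\Pi(\mu_1,\eta_2)}\int_{\Omega^2}\bar c_t\,d\gamma$ with $\bar c_t(x_1,x_2)=\inf_{z\in\Omega}\,t|x_2-z|^2+(1-t)|z-x_1|^2$.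 *)

theory Defs
  imports "HOL-Probability.Probability"
begin

text \<open>A Borel probability measure on a (closed) set Om of a Euclidean space is represented by a
  Borel probability measure on the whole space that gives full mass to Om. All costs are
  nonnegative and take values in the extended nonnegative reals.\<close>

definition prob_on :: "'a::euclidean_space set \<Rightarrow> 'a measure set" where
  "prob_on Om = {\<mu>. prob_space \<mu> \<and> sets \<mu> = sets borel \<and> emeasure \<mu> Om = 1}"

definition prob_ac_on :: "'a::euclidean_space set \<Rightarrow> 'a measure set" where
  "prob_ac_on Om = {\<mu> \<in> prob_on Om. absolutely_continuous lborel \<mu>}"

definition couplings :: "'a::euclidean_space measure \<Rightarrow> 'a measure \<Rightarrow> ('a \<times> 'a) measure set" where
  "couplings \<mu> \<nu> = {\<gamma>. prob_space \<gamma> \<and> sets \<gamma> = sets borel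
      \<and> distr \<gamma> borel fst = \<mu> \<and> distr \<gamma> borel snd = \<nu>}"

definition transport_cost :: "('a \<Rightarrow> 'a \<Rightarrow> real) \<Rightarrow> ('a::euclidean_space \<times> 'a) measure \<Rightarrow> ennreal" where
  "transport_cost c \<gamma> = (\<integral>\<^sup>+ z. ennreal (c (fst z) (snd z)) \<partial>\<gamma>)"

definition sq_dist :: "'a::euclidean_space \<Rightarrow> 'a \<Rightarrow> real" where
  "sq_dist x y = (norm (x - y))\<^sup>2"

definition W2_squared :: "'a::euclidean_space measure \<Rightarrow> 'a measure \<Rightarrow> ennreal" where
  "W2_squared \<mu> \<nu> = (INF \<gamma>\<in>couplings \<mu> \<nu>. transport_cost sq_dist \<gamma>)"

definition W2_optimal_map ::
  "'a::euclidean_space measure \<Rightarrow> 'a measure \<Rightarrow> ('a \<Rightarrow> 'a) \<Rightarrow> bool" where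
  "W2_optimal_map \<mu> \<nu> T \<longleftrightarrow> T \<in> borel_measurable borel \<and>
     is_arg_min (transport_cost sq_dist) (\<lambda>\<gamma>. \<gamma> \<in> couplings \<mu> \<nu>) (distr \<mu> borel (\<lambda>x. (x, T x)))"

definition disintegration ::
  "('a::euclidean_space \<times> 'a) measure \<Rightarrow> 'a measure \<Rightarrow> ('a \<Rightarrow> 'a measure) \<Rightarrow> bool" where
  "disintegration \<gamma> \<mu> \<kappa> \<longleftrightarrow> \<kappa> \<in> borel \<rightarrow>\<^sub>M prob_algebra borel \<and>
     (\<forall>A\<in>sets borel. emeasure \<gamma> A = (\<integral>\<^sup>+ x. emeasure (\<kappa> x) {y. (x, y) \<in> A} \<partial>\<mu>))"

text \<open>The cost of sending the second argument to the first, written T_2(nu | mu) in the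
  literature. The disintegration of a coupling is unique only up to null sets, which do not affect
  the cost, so the infimum runs over couplings together with their disintegrations.\<close>

definition weak_cost :: "'a::euclidean_space measure \<Rightarrow> 'a measure \<Rightarrow> ennreal" where
  "weak_cost \<nu> \<mu> = (INF (\<gamma>, \<kappa>) \<in> {(\<gamma>, \<kappa>). \<gamma> \<in> couplings \<mu> \<nu> \<and> disintegration \<gamma> \<mu> \<kappa>}.
     \<integral>\<^sup>+ x. ennreal ((norm (x - (\<integral>y. y \<partial>\<kappa> x)))\<^sup>2) \<partial>\<mu>)"

definition wC_objective ::
  "real \<Rightarrow> 'a::euclidean_space measure \<Rightarrow> 'a measure \<Rightarrow> 'a measure \<Rightarrow> ennreal" where
  "wC_objective t \<mu>1 \<mu>2 \<nu> = ennreal t * weak_cost \<mu>2 \<nu> + ennreal (1 - t) * weak_cost \<nu> \<mu>1"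

definition convex_order_le :: "'a::euclidean_space measure \<Rightarrow> 'a measure \<Rightarrow> bool" where
  "convex_order_le \<eta> \<mu> \<longleftrightarrow>
     (\<forall>\<phi> :: 'a \<Rightarrow> real. convex_on UNIV \<phi> \<longrightarrow> (\<integral>x. \<phi> x \<partial>\<eta>) \<le> (\<integral>x. \<phi> x \<partial>\<mu>))"

definition cbar :: "'a::euclidean_space set \<Rightarrow> real \<Rightarrow> 'a \<Rightarrow> 'a \<Rightarrow> real" where
  "cbar Om t x1 x2 = (INF z\<in>Om. t * (norm (x2 - z))\<^sup>2 + (1 - t) * (norm (z - x1))\<^sup>2)"

definition CMM ::
  "'a::euclidean_space set \<Rightarrow> real \<Rightarrow> 'a measure \<Rightarrow> 'a measure \<Rightarrow> ennreal" where
  "CMM Om t \<mu>1 \<eta>2 = (INF \<gamma>\<in>couplings \<mu>1 \<eta>2. transport_cost (cbar Om t) \<gamma>)"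

definition unique_arg_min :: "('b \<Rightarrow> 'c::order) \<Rightarrow> ('b \<Rightarrow> bool) \<Rightarrow> 'b \<Rightarrow> bool" where
  "unique_arg_min f P x \<longleftrightarrow> is_arg_min f P x \<and> (\<forall>y. is_arg_min f P y \<longrightarrow> y = x)"

text \<open>The differential relation d(Y s) = (T (Y 0) - Y 0) ds is read as the almost sure
  integral equation.\<close>

definition displacement_process ::
  "'w measure \<Rightarrow> (real \<Rightarrow> 'w \<Rightarrow> 'a::euclidean_space) \<Rightarrow> 'a measure \<Rightarrow> 'a measure \<Rightarrow> ('a \<Rightarrow> 'a) \<Rightarrow> bool"
where
  "displacement_process M Y \<mu> \<eta> T \<longleftrightarrow>
     prob_space M \<and>
     (\<forall>s\<in>{0..1}. Y s \<in> borel_measurable M) \<and>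
     distr M borel (Y 0) = \<mu> \<and>
     distr M borel (Y 1) = \<eta> \<and>
     (AE \<omega> in M. \<forall>s\<in>{0..1}.
        ((\<lambda>r. T (Y 0 \<omega>) - Y 0 \<omega>) has_integral (Y s \<omega> - Y 0 \<omega>)) {0..s})"

end

theory Submission
  imports Defs
begin

text \<open>
  Two independent facts combine.

  On a convex set the infimum defining the intermediate cost is attained at the point
  \<open>(1 - t) x1 + t x2\<close>, so \<open>cbar\<close> is \<open>t (1 - t)\<close> times the squared distance
  (\<open>cbar_eq\<close>). Hence a \<open>W2\<close>-projection of \<open>\<mu>1\<close> onto the measures dominated by \<open>\<mu>2\<close> also minimizes
  \<open>CMM\<close> (\<open>CMM_argmin_if_W2_argmin\<close>), and uniqueness of the latter minimizer forces
  \<open>\<eta>S = \<eta>2\<close>. This covers \<open>t = 0\<close> and \<open>t = 1\<close> as well, where \<open>CMM\<close> vanishes identically and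
  uniqueness of its minimizer leaves only one admissible measure.

  Then \<open>S\<close> and \<open>T\<close> are both optimal from the absolutely continuous measure \<open>\<mu>1\<close> to the same target,
  and they agree almost everywhere (\<open>W2_optimal_map_unique\<close>).
  The half-half mixture of the two graph couplings is again an optimal coupling. Draw two
  independent pairs \<open>(x, y)\<close>, \<open>(x', y')\<close> from an optimal coupling and exchange the targets exactly when
  \<open>(x - x') \<bullet> (y - y') < 0\<close>; the pair \<open>(x, y)\<close> or \<open>(x, y')\<close> so obtained follows a coupling with the
  same marginals, which is strictly cheaper unless such crossings have probability zero
  (\<open>optimal_imp_AE_not_crossing\<close>). Crossing is an open condition, so the support of the mixture is a
  monotone set that contains both graphs over almost every point. Finally, where \<open>S\<close> is close to
  \<open>p\<close> and \<open>T\<close> is close to \<open>q \<noteq> p\<close>, monotonicity allows at most one point on each line of direction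
  \<open>q - p\<close>; such a set is Lebesgue null, and countably many of them cover the set where
  \<open>S\<close> and \<open>T\<close> differ (\<open>monotone_selections_AE_eq\<close>).

  A displacement process has a constant velocity determined by its starting point, so
  \<open>Y t = (1 - t) Y 0 + t T (Y 0)\<close> almost surely, and its law is the image of \<open>\<mu>1\<close>
  under \<open>(1 - t) id + t T\<close>, which equals \<open>\<nu>\<close>.
\<close>

section \<open>The support of a Borel measure\<close>

definition measure_support :: "'b::topological_space measure \<Rightarrow> 'b set" where
  "measure_support M = - \<Union>{U. open U \<and> emeasure M U = 0}"

lemma closed_measure_support: "closed (measure_support M)"
  unfolding measure_support_def by (intro closed_Compl open_Union) auto

lemma emeasure_nbhd_of_support_point:
  "z \<in> measure_support M \<Longrightarrow> open U \<Longrightarrow> z \<in> U \<Longrightarrow> emeasure M U \<noteq> 0"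
  unfolding measure_support_def by auto

text \<open>The complement of the support is a union of open null sets, of which countably many suffice by
  the Lindelof property.\<close>
lemma AE_in_measure_support:
  fixes M :: "'b::second_countable_topology measure"
  assumes [measurable_cong]: "sets M = sets borel"
  shows "AE z in M. z \<in> measure_support M"
proof -
  let ?F = "{U. open U \<and> emeasure M U = 0}"
  obtain F where F: "F \<subseteq> ?F" "countable F" "\<Union>F = \<Union>?F"
    using Lindelof[of ?F] by auto
  have "(\<Union>U\<in>F. U) \<in> null_sets M"
    using F by (intro null_sets_UN') (auto simp: null_sets_def assms)
  then show ?thesis
    by (rule AE_I') (use F in \<open>auto simp: measure_support_def\<close>)
qed

section \<open>Optimal couplings have monotone support\<close>

text \<open>Pairs of points \<open>(x, y)\<close>, \<open>(x', y')\<close> for which exchanging the targets \<open>y\<close> and \<open>y'\<close> lowers the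
  quadratic cost: the saving is \<open>- 2 (x - x') \<bullet> (y - y')\<close>.\<close>
definition crossing :: "(('a::euclidean_space \<times> 'a) \<times> ('a \<times> 'a)) set" where
  "crossing = {p. (fst (fst p) - fst (snd p)) \<bullet> (snd (fst p) - snd (snd p)) < 0}"

lemma open_crossing: "open crossing"
  unfolding crossing_def by (intro open_Collect_less continuous_intros)

lemma crossing_swap: "prod.swap p \<in> crossing \<longleftrightarrow> p \<in> crossing"
  by (simp add: crossing_def algebra_simps)

text \<open>Exchanging two independent copies only when the pair lies in a symmetric event preserves their
  joint law, since on that event and on its complement the exchange is measure preserving.\<close>
lemma nn_integral_swap_on_symmetric_set:
  fixes M :: "'b::second_countable_topology measure" and f :: "'b \<times> 'b \<Rightarrow> ennreal"
  assumes M: "prob_space M" and s: "sets M = sets borel"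
    and A: "A \<in> sets borel" and sym: "\<And>p. prod.swap p \<in> A \<longleftrightarrow> p \<in> A"
    and f: "f \<in> borel_measurable borel"
  shows "(\<integral>\<^sup>+p. f (if p \<in> A then prod.swap p else p) \<partial>(M \<Otimes>\<^sub>M M)) = (\<integral>\<^sup>+p. f p \<partial>(M \<Otimes>\<^sub>M M))"
proof -
  interpret prob_space M by fact
  interpret pair_sigma_finite M M ..
  have [measurable_cong]: "sets (M \<Otimes>\<^sub>M M) = sets borel"
    by (rule trans[OF sets_pair_measure_cong[OF s s] arg_cong[where f = sets, OF borel_prod]])
  note [measurable] = A f
  have [measurable]: "prod.swap \<in> borel_measurable (borel :: ('b \<times> 'b) measure)"
    by (intro borel_measurable_continuous_onI continuous_on_swap)
  have swap: "(\<integral>\<^sup>+p. g (prod.swap p) \<partial>(M \<Otimes>\<^sub>M M)) = (\<integral>\<^sup>+p. g p \<partial>(M \<Otimes>\<^sub>M M))"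
    if [measurable]: "g \<in> borel_measurable borel" for g :: "'b \<times> 'b \<Rightarrow> ennreal"
    by (subst (2) distr_pair_swap) (simp add: nn_integral_distr split_beta prod.swap_def)
  have "(\<integral>\<^sup>+p. f (if p \<in> A then prod.swap p else p) \<partial>(M \<Otimes>\<^sub>M M))
      = (\<integral>\<^sup>+p. indicator A (prod.swap p) * f (prod.swap p) + indicator (-A) p * f p \<partial>(M \<Otimes>\<^sub>M M))"
    by (intro nn_integral_cong) (auto simp: sym)
  also have "\<dots> = (\<integral>\<^sup>+p. indicator A p * f p \<partial>(M \<Otimes>\<^sub>M M)) + (\<integral>\<^sup>+p. indicator (-A) p * f p \<partial>(M \<Otimes>\<^sub>M M))"
    by (subst nn_integral_add) (simp_all add: swap[of "\<lambda>p. indicator A p * f p", simplified])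
  also have "\<dots> = (\<integral>\<^sup>+p. indicator A p * f p + indicator (-A) p * f p \<partial>(M \<Otimes>\<^sub>M M))"
    by (subst nn_integral_add) simp_all
  also have "\<dots> = (\<integral>\<^sup>+p. f p \<partial>(M \<Otimes>\<^sub>M M))"
    by (intro nn_integral_cong) (auto simp: indicator_def)
  finally show ?thesis .
qed

text \<open>Competitor for the optimality of \<open>\<gamma>\<close>: sample two independent points of \<open>\<gamma>\<close> and keep the first one,
  except that on a crossing its target is replaced by the target of the second. Working on the product
  space turns this surgery on \<open>\<gamma>\<close> into a single image measure, whose marginals and cost
  follow from the symmetry of the crossing event.\<close>
lemma optimal_imp_AE_not_crossing:
  fixes \<gamma> :: "('a::euclidean_space \<times> 'a) measure"
  assumes \<gamma>: "\<gamma> \<in> couplings \<mu> \<nu>" and fin: "transport_cost sq_dist \<gamma> < \<infinity>"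
    and opt: "\<And>\<gamma>'. \<gamma>' \<in> couplings \<mu> \<nu> \<Longrightarrow> transport_cost sq_dist \<gamma> \<le> transport_cost sq_dist \<gamma>'"
  shows "AE p in \<gamma> \<Otimes>\<^sub>M \<gamma>. p \<notin> crossing"
proof -
  let ?P = "\<gamma> \<Otimes>\<^sub>M \<gamma>"
  have prob: "prob_space \<gamma>" and s: "sets \<gamma> = sets borel"
    and m1: "distr \<gamma> borel fst = \<mu>" and m2: "distr \<gamma> borel snd = \<nu>"
    using \<gamma> by (auto simp: couplings_def)
  interpret \<gamma>: prob_space \<gamma> by fact
  interpret P: pair_prob_space \<gamma> \<gamma> ..
  have sP[measurable_cong]: "sets ?P = sets borel"
    by (rule trans[OF sets_pair_measure_cong[OF s s] arg_cong[where f = sets, OF borel_prod]])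
  note s[measurable_cong]
  have cr[measurable]: "crossing \<in> sets (borel :: (('a \<times> 'a) \<times> ('a \<times> 'a)) measure)"
    by (intro borel_open open_crossing)
  define F where "F p = (if p \<in> crossing then (fst (fst p), snd (snd p)) else fst p)"
    for p :: "('a \<times> 'a) \<times> ('a \<times> 'a)"
  \<comment> \<open>The second marginal of the competitor is read off from the measure-preserving exchange
    \<open>\<phi>\<close>, because \<open>F\<close> and \<open>fst \<circ> \<phi>\<close> have the same second coordinate.\<close>
  define \<phi> where "\<phi> p = (if p \<in> crossing then prod.swap p else p)"
    for p :: "('a \<times> 'a) \<times> ('a \<times> 'a)"
  define c where "c z = ennreal (sq_dist (fst z) (snd z))" for z :: "'a \<times> 'a"
  have c[measurable]: "c \<in> borel_measurable borel"
    unfolding c_def sq_dist_def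
    by (intro measurable_compose[OF _ measurable_ennreal] borel_measurable_continuous_onI continuous_intros)
  have f1[measurable]: "fst \<in> borel_measurable (borel :: ('b::second_countable_topology \<times> 'b) measure)"
    and f2[measurable]: "snd \<in> borel_measurable (borel :: ('b::second_countable_topology \<times> 'b) measure)"
    and swap[measurable]: "prod.swap \<in> borel_measurable (borel :: ('b::second_countable_topology \<times> 'b) measure)"
    by (intro borel_measurable_continuous_onI continuous_intros continuous_on_swap)+
  have Fm[measurable]: "F \<in> borel_measurable borel"
    unfolding F_def by (intro measurable_If_set borel_measurable_Pair) auto
  have \<phi>m[measurable]: "\<phi> \<in> borel_measurable borel"
    unfolding \<phi>_def by (intro measurable_If_set) auto
  have fst_P: "distr ?P borel fst = \<gamma>"
    using \<gamma>.distr_pair_fst[of \<gamma>] by (subst distr_cong[OF refl s[symmetric] refl]) 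
  have int_fst: "(\<integral>\<^sup>+p. g (fst p) \<partial>?P) = (\<integral>\<^sup>+z. g z \<partial>\<gamma>)" if [measurable]: "g \<in> borel_measurable borel" for g
    by (subst fst_P[symmetric]) (simp add: nn_integral_distr)
  have int_swap: "(\<integral>\<^sup>+p. g (\<phi> p) \<partial>?P) = (\<integral>\<^sup>+p. g p \<partial>?P)" if "g \<in> borel_measurable borel" for g
    unfolding \<phi>_def
    by (intro nn_integral_swap_on_symmetric_set prob s cr crossing_swap that)
  have int_swap': "(\<integral>\<^sup>+p. g (prod.swap p) \<partial>?P) = (\<integral>\<^sup>+p. g p \<partial>?P)" if "g \<in> borel_measurable borel" for g
    using nn_integral_swap_on_symmetric_set[OF prob s _ _ that, of UNIV] by simp
  have snd_F: "snd (F p) = snd (fst (\<phi> p))" for p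
    by (simp add: F_def \<phi>_def)
  have "distr ?P borel F \<in> couplings \<mu> \<nu>"
    unfolding couplings_def
  proof (intro CollectI conjI)
    show "prob_space (distr ?P borel F)"
      by (intro P.prob_space_distr) measurable
    show "distr (distr ?P borel F) borel fst = \<mu>"
    proof -
      have "distr (distr ?P borel F) borel fst = distr ?P borel (\<lambda>p. fst (fst p))"
        by (subst distr_distr) (auto intro!: distr_cong simp: F_def)
      also have "\<dots> = distr (distr ?P borel fst) borel fst"
        by (subst distr_distr) (auto simp: comp_def)
      finally show ?thesis by (simp add: fst_P m1)
    qed
    show "distr (distr ?P borel F) borel snd = \<nu>"
    proof (rule measure_eqI)
      show "sets (distr (distr ?P borel F) borel snd) = sets \<nu>"
        unfolding m2[symmetric] by simp
      fix E assume "E \<in> sets (distr (distr ?P borel F) borel snd)"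
      then have [measurable]: "E \<in> sets borel" by simp
      have "emeasure (distr (distr ?P borel F) borel snd) E = (\<integral>\<^sup>+p. indicator E (snd (F p)) \<partial>?P)"
        by (simp add: nn_integral_distr flip: nn_integral_indicator)
      also have "\<dots> = (\<integral>\<^sup>+p. indicator E (snd (fst p)) \<partial>?P)"
        unfolding snd_F by (intro int_swap[of "\<lambda>p. indicator E (snd (fst p))"]) measurable
      also have "\<dots> = (\<integral>\<^sup>+z. indicator E (snd z) \<partial>\<gamma>)"
        by (intro int_fst[of "\<lambda>z. indicator E (snd z)"]) measurable
      also have "\<dots> = emeasure \<nu> E"
        unfolding m2[symmetric] by (simp add: nn_integral_distr flip: nn_integral_indicator)
      finally show "emeasure (distr (distr ?P borel F) borel snd) E = emeasure \<nu> E" .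
    qed
  qed simp
  then have le: "(\<integral>\<^sup>+z. c z \<partial>\<gamma>) \<le> (\<integral>\<^sup>+p. c (F p) \<partial>?P)"
    using opt by (force simp: transport_cost_def c_def[symmetric] nn_integral_distr)
  \<comment> \<open>The gain is kept on the cheaper side of an equation, so that all terms are nonnegative
    and no integrability has to be discussed.\<close>
  define G where "G p = ennreal (max 0 (- 2 * ((fst (fst p) - fst (snd p)) \<bullet> (snd (fst p) - snd (snd p)))))"
    for p :: "('a \<times> 'a) \<times> ('a \<times> 'a)"
  have G[measurable]: "G \<in> borel_measurable borel"
    unfolding G_def
    by (intro measurable_compose[OF _ measurable_ennreal] borel_measurable_continuous_onI continuous_intros)
  have pointwise: "c (fst p) + c (snd p) = c (F p) + c (F (prod.swap p)) + G p" for p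
  proof (cases "p \<in> crossing")
    case True
    then have cs: "prod.swap p \<in> crossing" by (simp add: crossing_swap)
    have neg: "(fst (fst p) - fst (snd p)) \<bullet> (snd (fst p) - snd (snd p)) < 0"
      using True by (simp add: crossing_def)
    show ?thesis
      using neg unfolding c_def G_def F_def if_P[OF True] if_P[OF cs]
      by (simp add: sq_dist_def flip: ennreal_plus)
        (simp add: power2_norm_eq_inner inner_diff inner_commute algebra_simps)
  next
    case False
    then have "prod.swap p \<notin> crossing" "G p = 0"
      by (simp_all add: crossing_swap) (simp add: G_def crossing_def ennreal_neg max_def)
    with False show ?thesis by (simp add: F_def)
  qed
  \<comment> \<open>Adding the identity for \<open>p\<close> to its mirror image makes the competitor appear twice; finiteness of
    the cost then allows cancellation.\<close>
  let ?C = "\<integral>\<^sup>+z. c z \<partial>\<gamma>" and ?C' = "\<integral>\<^sup>+p. c (F p) \<partial>?P"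
  have "?C + ?C = (\<integral>\<^sup>+p. c (fst p) + c (snd p) \<partial>?P)"
    using int_swap'[of "\<lambda>p. c (fst p)"] by (subst nn_integral_add) (auto simp: int_fst)
  also have "\<dots> = ?C' + ?C' + (\<integral>\<^sup>+p. G p \<partial>?P)"
    using int_swap'[of "\<lambda>p. c (F p)"] by (simp add: pointwise nn_integral_add)
  finally have eq: "?C + ?C = ?C' + ?C' + (\<integral>\<^sup>+p. G p \<partial>?P)" .
  have "?C < \<infinity>"
    using fin by (simp add: transport_cost_def c_def)
  moreover have "?C + ?C + (\<integral>\<^sup>+p. G p \<partial>?P) \<le> ?C + ?C + 0"
  proof -
    have "?C + ?C + (\<integral>\<^sup>+p. G p \<partial>?P) \<le> ?C' + ?C' + (\<integral>\<^sup>+p. G p \<partial>?P)"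
      by (intro add_mono le order_refl)
    then show ?thesis by (simp add: eq[symmetric])
  qed
  ultimately have "(\<integral>\<^sup>+p. G p \<partial>?P) = 0"
    by (subst (asm) ennreal_add_left_cancel_le) (auto simp: ennreal_add_eq_top)
  then have "AE p in ?P. G p = 0"
    by (subst (asm) nn_integral_0_iff_AE) auto
  then show ?thesis
    by eventually_elim (auto simp: G_def crossing_def max_def split: if_splits)
qed

text \<open>Crossing is an open condition: around a crossing pair of support points there would be a
  product of two open sets of positive measure consisting of crossings.\<close>
lemma support_not_crossing:
  fixes \<gamma> :: "('a::euclidean_space \<times> 'a) measure"
  assumes p: "prob_space \<gamma>" and s: "sets \<gamma> = sets borel"
    and ae: "AE p in \<gamma> \<Otimes>\<^sub>M \<gamma>. p \<notin> crossing"
    and z: "z \<in> measure_support \<gamma>" "z' \<in> measure_support \<gamma>"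
  shows "(z, z') \<notin> crossing"
proof
  interpret prob_space \<gamma> by fact
  assume "(z, z') \<in> crossing"
  then obtain U V where UV: "open U" "open V" "z \<in> U" "z' \<in> V" "U \<times> V \<subseteq> crossing"
    using open_prod_elim[OF open_crossing] by (metis mem_Sigma_iff)
  have m: "U \<in> sets \<gamma>" "V \<in> sets \<gamma>" using UV by (auto simp: s)
  have "AE p in \<gamma> \<Otimes>\<^sub>M \<gamma>. p \<notin> U \<times> V"
    using ae UV by (auto elim!: eventually_mono)
  then have "emeasure (\<gamma> \<Otimes>\<^sub>M \<gamma>) (U \<times> V) = 0"
    using m by (subst (asm) AE_iff_measurable[OF _ refl]) 
      (auto simp: space_pair_measure dest: sets.sets_into_space intro: arg_cong[where f="emeasure _"]
       elim!: back_subst[where P="\<lambda>A. emeasure _ A = 0"])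
  then have "emeasure \<gamma> U * emeasure \<gamma> V = 0"
    using m by (simp add: emeasure_pair_measure_Times)
  then show False
    using emeasure_nbhd_of_support_point[OF z(1) UV(1,3)] emeasure_nbhd_of_support_point[OF z(2) UV(2,4)] by simp
qed

section \<open>Maps with jointly monotone graphs agree almost everywhere\<close>

text \<open>The translates of such a set by distinct multiples of \<open>w\<close> are disjoint and have equal
  measure. For a bounded set, infinitely many of them fit into a ball, so the common measure is zero.\<close>
lemma null_set_if_thin_in_direction:
  fixes B :: "'a::euclidean_space set"
  assumes B[measurable]: "B \<in> sets borel" and w: "w \<noteq> 0"
    and thin: "\<And>x s. x \<in> B \<Longrightarrow> x + s *\<^sub>R w \<in> B \<Longrightarrow> s = 0"
  shows "B \<in> null_sets lborel"
proof -
  have bdd: "B' \<in> null_sets lborel" if B': "B' \<in> sets borel" "B' \<subseteq> B" "bounded B'" for B'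
  proof -
    define D where "D n = (+) (- (inverse (real (Suc n)) *\<^sub>R w)) -` B'" for n
    have Dm: "D n \<in> sets borel" for n
      unfolding D_def using measurable_sets_borel[OF _ B'(1), of "(+) (- (inverse (real (Suc n)) *\<^sub>R w))"]
      by measurable
    have De: "emeasure lborel (D n) = emeasure lborel B'" for n
      by (subst (2) lborel_distr_plus[of "- (inverse (real (Suc n)) *\<^sub>R w)", symmetric])
        (use B' in \<open>simp add: D_def emeasure_distr\<close>)
    have disj: "disjoint_family D"
    proof (unfold disjoint_family_on_def, intro ballI impI, rule ccontr)
      fix m n assume mn: "m \<noteq> n" "D m \<inter> D n \<noteq> {}"
      then obtain x where "x \<in> D m" "x \<in> D n" by auto
      then have "x - inverse (real (Suc m)) *\<^sub>R w \<in> B" "x - inverse (real (Suc n)) *\<^sub>R w \<in> B"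
        using B'(2) by (auto simp: D_def)
      then have "inverse (real (Suc m)) - inverse (real (Suc n)) = 0"
        by (intro thin[of "x - inverse (real (Suc m)) *\<^sub>R w"]) (auto simp: algebra_simps)
      with mn(1) show False by simp
    qed
    obtain K where K: "\<And>x. x \<in> B' \<Longrightarrow> norm x \<le> K"
      using B'(3) by (auto simp: bounded_iff)
    have "D n \<subseteq> cball 0 (K + norm w)" for n
    proof
      fix x assume "x \<in> D n"
      then have "norm (x - inverse (real (Suc n)) *\<^sub>R w) \<le> K" using K by (simp add: D_def)
      moreover have "norm (inverse (real (Suc n)) *\<^sub>R w) \<le> 1 * norm w"
        unfolding norm_scaleR by (intro mult_right_mono) (auto simp: inverse_le_1_iff)
      moreover have "norm x \<le> norm (x - inverse (real (Suc n)) *\<^sub>R w) + norm (inverse (real (Suc n)) *\<^sub>R w)"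
        using norm_triangle_sub[of x "inverse (real (Suc n)) *\<^sub>R w"] by (simp only: add.commute)
      ultimately show "x \<in> cball 0 (K + norm w)" by simp
    qed
    then have "emeasure lborel (\<Union>n. D n) \<le> emeasure lborel (cball 0 (K + norm w) :: 'a set)"
      using Dm by (intro emeasure_mono) auto
    also have "\<dots> < \<infinity>"
      by (intro emeasure_bounded_finite) auto
    finally have "(\<Sum>n. emeasure lborel (D n)) < \<infinity>"
      using Dm disj by (subst suminf_emeasure) auto
    then have fin: "(\<Sum>n::nat. emeasure lborel B') \<noteq> top"
      by (simp add: De)
    have "emeasure lborel B' = ennreal (measure lborel B')"
      using emeasure_bounded_finite[OF B'(3)] by (intro emeasure_eq_ennreal_measure) auto
    moreover from this have "summable (\<lambda>n::nat. measure lborel B')"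
      using fin by (intro summable_suminf_not_top) auto
    ultimately have "emeasure lborel B' = 0"
      by (simp add: summable_const_iff)
    then show ?thesis using B'(1) by auto
  qed
  have "(\<Union>n::nat. B \<inter> cball 0 (real n)) \<in> null_sets lborel"
    by (intro null_sets_UN bdd) auto
  moreover have "(\<Union>n::nat. B \<inter> cball 0 (real n)) = B"
    using real_arch_simple by auto
  ultimately show ?thesis by simp
qed

text \<open>The exceptional set is split into pieces on which \<open>S\<close> is nearly a constant \<open>p\<close> and \<open>T\<close> nearly
  a constant \<open>q\<close>. On such a piece \<open>T x - S x'\<close> is so close to \<open>w = q - p\<close> that monotonicity
  forces \<open>x - x'\<close>, when it is a multiple of \<open>w\<close>, to be a nonnegative one; exchanging \<open>x\<close> and \<open>x'\<close>
  shows that it is zero.\<close>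
lemma monotone_selections_AE_eq:
  fixes \<mu> :: "'a::euclidean_space measure"
  assumes s: "sets \<mu> = sets borel" and ac: "absolutely_continuous lborel \<mu>"
    and S[measurable]: "S \<in> borel_measurable borel" and T[measurable]: "T \<in> borel_measurable borel"
    and N[measurable]: "N \<in> sets borel" and NAE: "AE x in \<mu>. x \<in> N"
    and mono: "\<And>x x'. x \<in> N \<Longrightarrow> x' \<in> N \<Longrightarrow> (x - x') \<bullet> (T x - S x') \<ge> 0"
  shows "AE x in \<mu>. S x = T x"
proof -
  obtain D :: "'a set" where D: "countable D" "\<And>X. open X \<Longrightarrow> X \<noteq> {} \<Longrightarrow> \<exists>d\<in>D. d \<in> X"
    using countable_dense_setE by blast
  define B where "B p q = {x \<in> N. norm (S x - p) < norm (q - p) / 4 \<and> norm (T x - q) < norm (q - p) / 4}" for p q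
  have B[measurable]: "B p q \<in> sets borel" for p q
    unfolding B_def by measurable
  have null: "B p q \<in> null_sets lborel" for p q
  proof (cases "p = q")
    case True
    then have "B p q = {}" by (auto simp: B_def)
    then show ?thesis by simp
  next
    case False
    define w where "w = q - p"
    have w: "w \<noteq> 0" using False by (simp add: w_def)
    have one_sided: "r \<ge> 0" if x: "x \<in> B p q" "x + r *\<^sub>R w \<in> B p q" for x r
    proof -
      let ?x = "x + r *\<^sub>R w"
      define e where "e = T ?x - S x - w"
      have "e = (T ?x - q) - (S x - p)" by (simp add: e_def w_def)
      then have "norm e \<le> norm (T ?x - q) + norm (S x - p)"
        using norm_triangle_ineq4 by simp
      moreover have "norm (T ?x - q) < norm w / 4" "norm (S x - p) < norm w / 4"
        using x by (simp_all add: B_def w_def)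
      moreover have "norm w > 0" using w by simp
      ultimately have "norm e < norm w" by linarith
      moreover have "\<bar>w \<bullet> e\<bar> \<le> norm w * norm e"
        by (rule Cauchy_Schwarz_ineq2)
      ultimately have "\<bar>w \<bullet> e\<bar> < norm w * norm w"
        using w by (smt (verit) mult_strict_left_mono zero_less_norm_iff)
      then have pos: "w \<bullet> w + w \<bullet> e > 0"
        by (simp add: abs_less_iff flip: power2_norm_eq_inner) (simp add: power2_eq_square)
      have "0 \<le> (?x - x) \<bullet> (T ?x - S x)"
        using x by (intro mono) (auto simp: B_def)
      also have "\<dots> = r * (w \<bullet> w + w \<bullet> e)"
        by (simp add: e_def inner_diff_right algebra_simps)
      finally show "r \<ge> 0" using pos by (simp add: zero_le_mult_iff)
    qed
    show ?thesis
    proof (rule null_set_if_thin_in_direction[OF B w])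
      fix x r assume x: "x \<in> B p q" "x + r *\<^sub>R w \<in> B p q"
      have "r \<ge> 0" using one_sided[OF x] .
      moreover have "- r \<ge> 0" using one_sided[of "x + r *\<^sub>R w" "- r"] x by simp
      ultimately show "r = 0" by simp
    qed
  qed
  have "(\<Union>p\<in>D. \<Union>q\<in>D. B p q) \<in> null_sets lborel"
    by (intro null_sets_UN' D(1) null)
  then have "(\<Union>p\<in>D. \<Union>q\<in>D. B p q) \<in> null_sets \<mu>"
    using ac by (auto simp: absolutely_continuous_def)
  then have "AE x in \<mu>. x \<notin> (\<Union>p\<in>D. \<Union>q\<in>D. B p q)"
    by (rule AE_not_in)
  with NAE show ?thesis
  proof eventually_elim
    case (elim x)
    show ?case
    proof (rule ccontr)
      assume "S x \<noteq> T x"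
      define r where "r = dist (S x) (T x)"
      have r: "r > 0" using \<open>S x \<noteq> T x\<close> by (simp add: r_def)
      \<comment> \<open>Tolerance \<open>r / 8\<close> gives \<open>dist p q > 3 r / 4\<close>, hence \<open>r / 8 < dist p q / 4\<close>.\<close>
      obtain p where p: "p \<in> D" "dist (S x) p < r / 8"
        using D(2)[of "ball (S x) (r / 8)"] r by auto
      obtain q where q: "q \<in> D" "dist (T x) q < r / 8"
        using D(2)[of "ball (T x) (r / 8)"] r by auto
      have "r \<le> dist (S x) p + dist p q + dist q (T x)"
        unfolding r_def by (metis add_right_mono dist_triangle order_trans)
      then have "dist p q > r * 3 / 4" using p q by (simp add: dist_commute)
      then have "x \<in> B p q"
        using p q r elim(1) unfolding B_def by (auto simp: dist_norm norm_minus_commute)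
      then show False using elim(2) p q by auto
    qed
  qed
qed


section \<open>Mixing two couplings\<close>
lemma ennreal_half_add_half: "ennreal (1 / 2) * a + ennreal (1 / 2) * a = a"
  unfolding distrib_right[symmetric] by (subst ennreal_plus[symmetric]) simp_all

definition half_mixture :: "'b::second_countable_topology measure \<Rightarrow> 'b measure \<Rightarrow> 'b measure" where
  "half_mixture M N = measure_pmf (bernoulli_pmf (1 / 2)) \<bind> (\<lambda>b. if b then M else N)"

lemma
  fixes M N :: "'b::second_countable_topology measure"
  assumes M: "prob_space M" "sets M = sets borel" and N: "prob_space N" "sets N = sets borel"
  shows sets_half_mixture: "sets (half_mixture M N) = sets borel"
    and prob_space_half_mixture: "prob_space (half_mixture M N)"
    and nn_integral_half_mixture: "f \<in> borel_measurable borel \<Longrightarrow>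
      (\<integral>\<^sup>+z. f z \<partial>half_mixture M N)
        = ennreal (1 / 2) * (\<integral>\<^sup>+z. f z \<partial>M) + ennreal (1 / 2) * (\<integral>\<^sup>+z. f z \<partial>N)"
proof -
  have K: "(\<lambda>b. if b then M else N) \<in> measure_pmf (bernoulli_pmf (1 / 2)) \<rightarrow>\<^sub>M subprob_algebra borel"
    using M N by (auto simp: space_subprob_algebra prob_space_imp_subprob_space)
  show s: "sets (half_mixture M N) = sets borel"
    unfolding half_mixture_def by (rule sets_bind[OF sets_kernel[OF K]]) auto
  show nn: "(\<integral>\<^sup>+z. f z \<partial>half_mixture M N)
        = ennreal (1 / 2) * (\<integral>\<^sup>+z. f z \<partial>M) + ennreal (1 / 2) * (\<integral>\<^sup>+z. f z \<partial>N)"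
    if "f \<in> borel_measurable borel" for f
    unfolding half_mixture_def
    by (subst nn_integral_bind[OF that K]) (simp add: mult.commute)
  show "prob_space (half_mixture M N)"
  proof
    have "emeasure (half_mixture M N) (space (half_mixture M N)) = (\<integral>\<^sup>+z. 1 \<partial>half_mixture M N)"
      by simp
    also have "\<dots> = ennreal (1 / 2) * 1 + ennreal (1 / 2) * 1"
      by (subst nn) (simp_all add: M N prob_space.emeasure_space_1)
    also have "\<dots> = 1" by (rule ennreal_half_add_half)
    finally show "emeasure (half_mixture M N) (space (half_mixture M N)) = 1" .
  qed
qed

lemma AE_half_mixtureD:
  fixes M N :: "'b::second_countable_topology measure"
  assumes M: "prob_space M" "sets M = sets borel" and N: "prob_space N" "sets N = sets borel"
    and A[measurable]: "A \<in> sets borel" and ae: "AE z in half_mixture M N. z \<in> A"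
  shows "AE z in M. z \<in> A" and "AE z in N. z \<in> A"
proof -
  note [measurable_cong] = M(2) N(2) sets_half_mixture[OF M N]
  have "(\<integral>\<^sup>+z. indicator (-A) z \<partial>half_mixture M N) = 0"
    using ae by (subst nn_integral_0_iff_AE) (auto elim: eventually_mono)
  then have "(\<integral>\<^sup>+z. indicator (-A) z \<partial>M) = 0" "(\<integral>\<^sup>+z. indicator (-A) z \<partial>N) = 0"
    by (simp_all only: nn_integral_half_mixture[OF M N borel_measurable_indicator] borel_comp A) 
      (auto simp: add_eq_0_iff_both_eq_0 ennreal_eq_0_iff)
  then show "AE z in M. z \<in> A" "AE z in N. z \<in> A"
    by (subst (asm) (1 2) nn_integral_0_iff_AE; auto simp: indicator_def elim: eventually_mono)+
qed

lemma half_mixture_couplings: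
  assumes "\<gamma>1 \<in> couplings \<mu> \<nu>" "\<gamma>2 \<in> couplings \<mu> \<nu>"
  shows "half_mixture \<gamma>1 \<gamma>2 \<in> couplings \<mu> \<nu>"
proof -
  have M: "prob_space \<gamma>1" "sets \<gamma>1 = sets borel" and N: "prob_space \<gamma>2" "sets \<gamma>2 = sets borel"
    and m: "distr \<gamma>1 borel fst = \<mu>" "distr \<gamma>1 borel snd = \<nu>" "distr \<gamma>2 borel fst = \<mu>" "distr \<gamma>2 borel snd = \<nu>"
    using assms by (auto simp: couplings_def)
  note [measurable_cong] = M(2) N(2) sets_half_mixture[OF M N]
  have marginal: "distr (half_mixture \<gamma>1 \<gamma>2) borel h = \<rho>"
    if [measurable]: "h \<in> borel_measurable borel" and h: "distr \<gamma>1 borel h = \<rho>" "distr \<gamma>2 borel h = \<rho>"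
    for h and \<rho> :: "'a measure"
  proof (rule measure_eqI)
    show "sets (distr (half_mixture \<gamma>1 \<gamma>2) borel h) = sets \<rho>"
      using h by auto
    fix E assume "E \<in> sets (distr (half_mixture \<gamma>1 \<gamma>2) borel h)"
    then have [measurable]: "E \<in> sets borel" by simp
    have 1: "(\<integral>\<^sup>+z. indicator E (h z) \<partial>\<gamma>1) = emeasure \<rho> E"
      unfolding h(1)[symmetric] by (simp add: nn_integral_distr flip: nn_integral_indicator)
    have 2: "(\<integral>\<^sup>+z. indicator E (h z) \<partial>\<gamma>2) = emeasure \<rho> E"
      unfolding h(2)[symmetric] by (simp add: nn_integral_distr flip: nn_integral_indicator)
    have "emeasure (distr (half_mixture \<gamma>1 \<gamma>2) borel h) E = (\<integral>\<^sup>+z. indicator E (h z) \<partial>half_mixture \<gamma>1 \<gamma>2)"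
      by (simp add: nn_integral_distr flip: nn_integral_indicator)
    also have "\<dots> = emeasure \<rho> E"
      by (subst nn_integral_half_mixture[OF M N]) (measurable, simp only: 1 2 ennreal_half_add_half)
    finally show "emeasure (distr (half_mixture \<gamma>1 \<gamma>2) borel h) E = emeasure \<rho> E" .
  qed
  have "fst \<in> borel_measurable (borel :: ('a \<times> 'a) measure)" "snd \<in> borel_measurable (borel :: ('a \<times> 'a) measure)"
    by (intro borel_measurable_continuous_onI continuous_intros)+
  then show ?thesis
    unfolding couplings_def
    using marginal m sets_half_mixture[OF M N] prob_space_half_mixture[OF M N] by auto
qed

section \<open>Uniqueness of the optimal map\<close>
lemma couplings_marginal:
  assumes "\<gamma> \<in> couplings \<mu> \<nu>"
  shows "prob_space \<mu>" "sets \<mu> = sets borel" "prob_space \<nu>" "sets \<nu> = sets borel"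
proof -
  have [measurable_cong]: "sets \<gamma> = sets borel" and p: "prob_space \<gamma>"
    and m: "\<mu> = distr \<gamma> borel fst" "\<nu> = distr \<gamma> borel snd"
    using assms by (auto simp: couplings_def)
  have "fst \<in> borel_measurable \<gamma>" "snd \<in> borel_measurable \<gamma>"
    unfolding measurable_cong_sets[OF \<open>sets \<gamma> = sets borel\<close> refl]
    by (intro borel_measurable_continuous_onI continuous_intros)+
  then show "prob_space \<mu>" "prob_space \<nu>"
    unfolding m by (auto intro: prob_space.prob_space_distr[OF p])
  show "sets \<mu> = sets borel" "sets \<nu> = sets borel"
    unfolding m by auto
qed

lemma W2_optimal_map_coupling:
  assumes "W2_optimal_map \<mu> \<nu> S"
  shows "distr \<mu> borel (\<lambda>x. (x, S x)) \<in> couplings \<mu> \<nu>"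
    and "\<gamma> \<in> couplings \<mu> \<nu> \<Longrightarrow>
      transport_cost sq_dist (distr \<mu> borel (\<lambda>x. (x, S x))) \<le> transport_cost sq_dist \<gamma>"
  using assms by (auto simp: W2_optimal_map_def is_arg_min_linorder)

lemma W2_optimal_map_push:
  assumes "W2_optimal_map \<mu> \<nu> S"
  shows "distr \<mu> borel S = \<nu>"
proof -
  note c = W2_optimal_map_coupling(1)[OF assms]
  have s: "sets \<mu> = sets borel" by (rule couplings_marginal[OF c])
  note [measurable_cong] = s
  have [measurable]: "S \<in> borel_measurable borel" using assms by (simp add: W2_optimal_map_def)
  have "snd \<in> borel_measurable (borel :: ('a \<times> 'a) measure)"
    by (intro borel_measurable_continuous_onI continuous_intros)
  then have "distr (distr \<mu> borel (\<lambda>x. (x, S x))) borel snd = distr \<mu> borel S"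
    by (subst distr_distr) (auto simp: comp_def)
  then show ?thesis using c by (simp add: couplings_def)
qed

text \<open>The mixture of the two graph couplings is optimal, and its support contains both graphs over
  almost every point. Applying monotonicity to the mixture, and not to each graph separately,
  is what yields an inequality between values of \<open>S\<close> and values of \<open>T\<close>.\<close>
lemma W2_optimal_map_unique:
  fixes \<mu> \<nu> :: "'a::euclidean_space measure"
  assumes ac: "absolutely_continuous lborel \<mu>" and fin: "W2_squared \<mu> \<nu> < \<infinity>"
    and S: "W2_optimal_map \<mu> \<nu> S" and T: "W2_optimal_map \<mu> \<nu> T"
  shows "AE x in \<mu>. S x = T x"
proof -
  let ?gr = "\<lambda>R. distr \<mu> borel (\<lambda>x. (x, R x))"
  have [measurable]: "S \<in> borel_measurable borel" "T \<in> borel_measurable borel"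
    using S T by (auto simp: W2_optimal_map_def)
  note cS = W2_optimal_map_coupling(1)[OF S] and cT = W2_optimal_map_coupling(1)[OF T]
  note s = couplings_marginal(2)[OF cS]
  note s[measurable_cong]
  have p: "prob_space (?gr S)" "prob_space (?gr T)" and sg: "sets (?gr S) = sets borel" "sets (?gr T) = sets borel"
    using cS cT by (auto simp: couplings_def)
  define \<gamma> where "\<gamma> = half_mixture (?gr S) (?gr T)"
  have \<gamma>: "\<gamma> \<in> couplings \<mu> \<nu>"
    unfolding \<gamma>_def by (intro half_mixture_couplings cS cT)
  have p\<gamma>: "prob_space \<gamma>" and s\<gamma>: "sets \<gamma> = sets borel"
    using \<gamma> by (auto simp: couplings_def)
  have "transport_cost sq_dist (?gr S) = transport_cost sq_dist (?gr T)"
    by (intro antisym W2_optimal_map_coupling[OF S] W2_optimal_map_coupling[OF T])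
  moreover have "(\<lambda>z::'a \<times> 'a. ennreal (sq_dist (fst z) (snd z))) \<in> borel_measurable borel"
    unfolding sq_dist_def
    by (intro measurable_compose[OF _ measurable_ennreal] borel_measurable_continuous_onI continuous_intros)
  ultimately have cost: "transport_cost sq_dist \<gamma> = transport_cost sq_dist (?gr S)"
    unfolding transport_cost_def \<gamma>_def
    by (subst nn_integral_half_mixture[OF p(1) sg(1) p(2) sg(2)]) (simp_all only: ennreal_half_add_half)
  have opt: "transport_cost sq_dist \<gamma> \<le> transport_cost sq_dist \<gamma>'" if "\<gamma>' \<in> couplings \<mu> \<nu>" for \<gamma>'
    unfolding cost by (rule W2_optimal_map_coupling(2)[OF S that])
  obtain \<gamma>' where "\<gamma>' \<in> couplings \<mu> \<nu>" "transport_cost sq_dist \<gamma>' < \<infinity>"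
    using fin by (auto simp: W2_squared_def INF_less_iff)
  then have "transport_cost sq_dist \<gamma> < \<infinity>"
    using opt by (meson le_less_trans)
  then have ncr: "AE p in \<gamma> \<Otimes>\<^sub>M \<gamma>. p \<notin> crossing"
    by (intro optimal_imp_AE_not_crossing[OF \<gamma>] opt)
  let ?X = "measure_support \<gamma>"
  have X[measurable]: "?X \<in> sets borel"
    by (intro borel_closed closed_measure_support)
  have "AE z in half_mixture (?gr S) (?gr T). z \<in> ?X"
    using AE_in_measure_support[OF s\<gamma>] unfolding \<gamma>_def .
  then have "AE z in ?gr S. z \<in> ?X" "AE z in ?gr T. z \<in> ?X"
    by (rule AE_half_mixtureD[OF p(1) sg(1) p(2) sg(2) X])+
  then have "AE x in \<mu>. (x, S x) \<in> ?X" "AE x in \<mu>. (x, T x) \<in> ?X"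
    by (simp_all add: AE_distr_iff)
  then have "AE x in \<mu>. x \<in> {x. (x, S x) \<in> ?X \<and> (x, T x) \<in> ?X}"
    by auto
  then show ?thesis
  proof (rule monotone_selections_AE_eq[OF s ac, rotated 3])
    show "{x. (x, S x) \<in> ?X \<and> (x, T x) \<in> ?X} \<in> sets borel"
      by measurable
    fix x x' assume "x \<in> {x. (x, S x) \<in> ?X \<and> (x, T x) \<in> ?X}" "x' \<in> {x. (x, S x) \<in> ?X \<and> (x, T x) \<in> ?X}"
    then have "((x, T x), (x', S x')) \<notin> crossing"
      by (intro support_not_crossing[OF p\<gamma> s\<gamma> ncr]) auto
    then show "(x - x') \<bullet> (T x - S x') \<ge> 0"
      by (simp add: crossing_def)
  qed measurable
qed

section \<open>The intermediate cost on a convex set\<close>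
lemma prob_on_AE:
  assumes "\<mu> \<in> prob_on Om" "Om \<in> sets borel"
  shows "AE x in \<mu>. x \<in> Om"
proof -
  interpret prob_space \<mu> using assms by (simp add: prob_on_def)
  show ?thesis
    using assms by (intro AE_prob_1) (simp add: prob_on_def measure_def)
qed

lemma couplings_AE_in:
  assumes \<gamma>: "\<gamma> \<in> couplings \<mu> \<nu>" and m: "\<mu> \<in> prob_on Om" "\<nu> \<in> prob_on Om" "Om \<in> sets borel"
  shows "AE z in \<gamma>. fst z \<in> Om \<and> snd z \<in> Om"
proof -
  have s: "sets \<gamma> = sets borel" and m': "distr \<gamma> borel fst = \<mu>" "distr \<gamma> borel snd = \<nu>"
    using \<gamma> by (auto simp: couplings_def)
  have f: "fst \<in> borel_measurable \<gamma>" "snd \<in> borel_measurable \<gamma>"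
    unfolding measurable_cong_sets[OF s refl]
    by (intro borel_measurable_continuous_onI continuous_intros)+
  have "AE z in \<gamma>. fst z \<in> Om" "AE z in \<gamma>. snd z \<in> Om"
    using prob_on_AE[OF m(1,3)] prob_on_AE[OF m(2,3)] m(3) unfolding m'[symmetric]
    by (simp_all add: AE_distr_iff f)
  then show ?thesis by auto
qed

text \<open>Completing the square in \<open>z\<close> leaves \<open>\<bar>z - ((1 - t) x1 + t x2)\<bar>\<^sup>2\<close>, which vanishes
  at a point of the convex set.\<close>
lemma cbar_eq:
  fixes Om :: "'a::euclidean_space set"
  assumes "convex Om" "x1 \<in> Om" "x2 \<in> Om" "t \<in> {0..1}"
  shows "cbar Om t x1 x2 = t * (1 - t) * sq_dist x1 x2"
proof -
  have id: "t * (norm (x2 - z))\<^sup>2 + (1 - t) * (norm (z - x1))\<^sup>2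
    = t * (1 - t) * sq_dist x1 x2 + (norm (z - ((1 - t) *\<^sub>R x1 + t *\<^sub>R x2)))\<^sup>2" for z
    by (simp add: sq_dist_def power2_norm_eq_inner inner_diff inner_add inner_commute algebra_simps)
  have "(1 - t) *\<^sub>R x1 + t *\<^sub>R x2 \<in> Om"
    using assms by (intro convexD) auto
  then show ?thesis
    unfolding cbar_def id by (intro cInf_eq_minimum) force+
qed

lemma transport_cost_cbar:
  assumes "\<gamma> \<in> couplings \<mu> \<nu>" "\<mu> \<in> prob_on Om" "\<nu> \<in> prob_on Om" "Om \<in> sets borel" "convex Om" "t \<in> {0..1}"
  shows "transport_cost (cbar Om t) \<gamma> = ennreal (t * (1 - t)) * transport_cost sq_dist \<gamma>"
proof -
  have s[measurable_cong]: "sets \<gamma> = sets borel" using assms by (simp add: couplings_def)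
  have [measurable]: "(\<lambda>z::'a \<times> 'a. ennreal (sq_dist (fst z) (snd z))) \<in> borel_measurable borel"
    unfolding sq_dist_def
    by (intro measurable_compose[OF _ measurable_ennreal] borel_measurable_continuous_onI continuous_intros)
  have "transport_cost (cbar Om t) \<gamma> = (\<integral>\<^sup>+z. ennreal (t * (1 - t)) * ennreal (sq_dist (fst z) (snd z)) \<partial>\<gamma>)"
    unfolding transport_cost_def
    using couplings_AE_in[OF assms(1-4)]
    by (intro nn_integral_cong_AE, eventually_elim)
      (use assms in \<open>auto simp: cbar_eq ennreal_mult sq_dist_def\<close>)
  then show ?thesis
    unfolding transport_cost_def by (simp add: nn_integral_cmult)
qed

lemma transport_cost_finite:
  assumes "\<gamma> \<in> couplings \<mu> \<nu>" "\<mu> \<in> prob_on Om" "\<nu> \<in> prob_on Om" "compact Om"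
  shows "transport_cost sq_dist \<gamma> < \<infinity>"
proof -
  interpret prob_space \<gamma> using assms by (simp add: couplings_def)
  obtain K where K: "\<And>x. x \<in> Om \<Longrightarrow> norm x \<le> K"
    using compact_imp_bounded[OF assms(4)] by (auto simp: bounded_iff)
  have "transport_cost sq_dist \<gamma> \<le> (\<integral>\<^sup>+z. ennreal ((K + K)\<^sup>2) \<partial>\<gamma>)"
    unfolding transport_cost_def
    using couplings_AE_in[OF assms(1-3) borel_compact[OF assms(4)]]
  proof (intro nn_integral_mono_AE, eventually_elim)
    case (elim z)
    then have "norm (fst z - snd z) \<le> K + K"
      using K norm_triangle_ineq4[of "fst z" "snd z"] by (meson add_mono order_trans)
    then show ?case
      unfolding sq_dist_def by (intro ennreal_leI power_mono) auto
  qed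
  also have "\<dots> < \<infinity>" by (simp add: emeasure_space_1)
  finally show ?thesis .
qed

text \<open>All couplings between measures on the convex set have \<open>cbar\<close>-cost equal to \<open>t (1 - t)\<close> times their
  quadratic cost. The optimal map supplies a coupling that attains \<open>W2_squared \<mu> \<eta>\<close>, so costs of couplings
  can be compared directly, even when the factor is zero.\<close>
lemma CMM_argmin_if_W2_argmin:
  assumes Om: "compact Om" "convex Om" and \<mu>: "\<mu> \<in> prob_on Om" and t: "t \<in> {0..1}"
    and P: "\<And>\<eta>. P \<eta> \<Longrightarrow> \<eta> \<in> prob_on Om"
    and min: "is_arg_min (W2_squared \<mu>) P \<eta>" and T: "W2_optimal_map \<mu> \<eta> T"
  shows "is_arg_min (CMM Om t \<mu>) P \<eta>"
proof -
  let ?g = "distr \<mu> borel (\<lambda>x. (x, T x))"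
  have B: "Om \<in> sets borel" using Om by (simp add: borel_compact)
  have "P \<eta>" and le: "\<And>\<eta>'. P \<eta>' \<Longrightarrow> W2_squared \<mu> \<eta> \<le> W2_squared \<mu> \<eta>'"
    using min by (auto simp: is_arg_min_linorder)
  have "CMM Om t \<mu> \<eta> \<le> CMM Om t \<mu> \<eta>'" if "P \<eta>'" for \<eta>'
    unfolding CMM_def[of _ _ _ \<eta>']
  proof (rule INF_greatest)
    fix \<gamma> assume \<gamma>: "\<gamma> \<in> couplings \<mu> \<eta>'"
    have "transport_cost sq_dist ?g \<le> W2_squared \<mu> \<eta>"
      unfolding W2_squared_def by (intro INF_greatest W2_optimal_map_coupling[OF T])
    also have "\<dots> \<le> W2_squared \<mu> \<eta>'" by (rule le[OF that])
    also have "\<dots> \<le> transport_cost sq_dist \<gamma>"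
      unfolding W2_squared_def by (rule INF_lower[OF \<gamma>])
    finally have "transport_cost sq_dist ?g \<le> transport_cost sq_dist \<gamma>" .
    have "CMM Om t \<mu> \<eta> \<le> transport_cost (cbar Om t) ?g"
      unfolding CMM_def by (intro INF_lower W2_optimal_map_coupling[OF T])
    also have "\<dots> = ennreal (t * (1 - t)) * transport_cost sq_dist ?g"
      by (rule transport_cost_cbar[OF W2_optimal_map_coupling(1)[OF T] \<mu> P[OF \<open>P \<eta>\<close>] B Om(2) t])
    also have "\<dots> \<le> ennreal (t * (1 - t)) * transport_cost sq_dist \<gamma>"
      by (rule mult_left_mono) (fact, simp)
    also have "\<dots> = transport_cost (cbar Om t) \<gamma>"
      by (rule transport_cost_cbar[OF \<gamma> \<mu> P[OF that] B Om(2) t, symmetric])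
    finally show "CMM Om t \<mu> \<eta> \<le> transport_cost (cbar Om t) \<gamma>" .
  qed
  with \<open>P \<eta>\<close> show ?thesis by (auto simp: is_arg_min_linorder)
qed

section \<open>Displacement processes\<close>
lemma displacement_process_distr:
  assumes Y: "displacement_process M Y \<mu> \<eta> T" and t: "t \<in> {0..1}" and T[measurable]: "T \<in> borel_measurable borel"
  shows "distr M borel (Y t) = distr \<mu> borel (\<lambda>x. (1 - t) *\<^sub>R x + t *\<^sub>R T x)"
proof -
  have Ym[measurable]: "Y t \<in> borel_measurable M" "Y 0 \<in> borel_measurable M" and Y0: "distr M borel (Y 0) = \<mu>"
    and ae: "AE \<omega> in M. \<forall>s\<in>{0..1}.
        ((\<lambda>r. T (Y 0 \<omega>) - Y 0 \<omega>) has_integral (Y s \<omega> - Y 0 \<omega>)) {0..s}"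
    using Y t by (auto simp: displacement_process_def)
  have "AE \<omega> in M. Y t \<omega> = (1 - t) *\<^sub>R Y 0 \<omega> + t *\<^sub>R T (Y 0 \<omega>)"
    using ae
  proof eventually_elim
    case (elim \<omega>)
    then have "((\<lambda>r. T (Y 0 \<omega>) - Y 0 \<omega>) has_integral (Y t \<omega> - Y 0 \<omega>)) {0..t}"
      using t by blast
    moreover have "((\<lambda>r. T (Y 0 \<omega>) - Y 0 \<omega>) has_integral (t *\<^sub>R (T (Y 0 \<omega>) - Y 0 \<omega>))) {0..t}"
      using has_integral_const_real[of "T (Y 0 \<omega>) - Y 0 \<omega>" 0 t] t by simp
    ultimately have "Y t \<omega> - Y 0 \<omega> = t *\<^sub>R (T (Y 0 \<omega>) - Y 0 \<omega>)"
      by (rule has_integral_unique)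
    then show ?case by (simp add: algebra_simps)
  qed
  then have "distr M borel (Y t) = distr M borel (\<lambda>\<omega>. (1 - t) *\<^sub>R Y 0 \<omega> + t *\<^sub>R T (Y 0 \<omega>))"
    by (intro distr_cong_AE) auto
  also have "\<dots> = distr \<mu> borel (\<lambda>x. (1 - t) *\<^sub>R x + t *\<^sub>R T x)"
    unfolding Y0[symmetric] by (subst distr_distr) (auto simp: comp_def)
  finally show ?thesis .
qed

lemma displacement_process_exists:
  assumes p: "prob_space \<mu>" and s[measurable_cong]: "sets \<mu> = sets borel" and T[measurable]: "T \<in> borel_measurable borel"
    and push: "distr \<mu> borel T = \<eta>"
  shows "displacement_process \<mu> (\<lambda>s x. x + s *\<^sub>R (T x - x)) \<mu> \<eta> T"
  unfolding displacement_process_def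
proof (intro conjI ballI AE_I2)
  show "distr \<mu> borel (\<lambda>x. x + 0 *\<^sub>R (T x - x)) = \<mu>"
    using s by (simp add: distr_id2)
  fix r :: real and x assume "r \<in> {0..1}"
  then show "((\<lambda>_. T (x + 0 *\<^sub>R (T x - x)) - (x + 0 *\<^sub>R (T x - x))) has_integral
      (x + r *\<^sub>R (T x - x) - (x + 0 *\<^sub>R (T x - x)))) {0..r}"
    using has_integral_const_real[of "T x - x" 0 r] by simp
qed (use p push in \<open>simp_all\<close>)

section \<open>The displacement interpolation solves the weak barycenter problem\<close>
theorem theorem4p4:
  fixes Om :: "'a::euclidean_space set"
    and \<mu>1 \<mu>2 \<eta>S \<eta>2 \<nu> :: "'a measure"
    and S T :: "'a \<Rightarrow> 'a"
    and \<phi> :: "'a \<Rightarrow> real"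
    and t :: real
  assumes "compact Om" and "convex Om"
    and "\<mu>1 \<in> prob_ac_on Om" and "\<mu>2 \<in> prob_on Om"
    and "t \<in> {0..1}"
    and "unique_arg_min (CMM Om t \<mu>1) (\<lambda>\<eta>. \<eta> \<in> prob_on Om \<and> convex_order_le \<eta> \<mu>2) \<eta>S"
    and "W2_optimal_map \<mu>1 \<eta>S S"
    and "\<nu> = distr \<mu>1 borel (\<lambda>x. (1 - t) *\<^sub>R x + t *\<^sub>R S x)"
    and "is_arg_min (wC_objective t \<mu>1 \<mu>2) (\<lambda>\<nu>'. \<nu>' \<in> prob_on Om) \<nu>"
    and "unique_arg_min (W2_squared \<mu>1) (\<lambda>\<eta>. \<eta> \<in> prob_on Om \<and> convex_order_le \<eta> \<mu>2) \<eta>2"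
    and "W2_optimal_map \<mu>1 \<eta>2 T"
    and "AE x in \<mu>1. GDERIV \<phi> x :> T x"
  shows "(\<exists>(M :: 'a measure) Y. displacement_process M Y \<mu>1 \<eta>2 T \<and> distr M borel (Y t) = \<nu>)
    \<and> (\<forall>(M :: 'w measure) Y. displacement_process M Y \<mu>1 \<eta>2 T \<longrightarrow> distr M borel (Y t) = \<nu>)"
proof -
  let ?P = "\<lambda>\<eta>. \<eta> \<in> prob_on Om \<and> convex_order_le \<eta> \<mu>2"
  have \<mu>1: "\<mu>1 \<in> prob_on Om" and ac: "absolutely_continuous lborel \<mu>1"
    using assms(3) by (auto simp: prob_ac_on_def)
  have p: "prob_space \<mu>1" and s[measurable_cong]: "sets \<mu>1 = sets borel"
    using \<mu>1 by (auto simp: prob_on_def)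
  have min: "is_arg_min (W2_squared \<mu>1) ?P \<eta>2" using assms(10) by (simp add: unique_arg_min_def)
  then have \<eta>2: "\<eta>2 \<in> prob_on Om" by (simp add: is_arg_min_def)
  have "is_arg_min (CMM Om t \<mu>1) ?P \<eta>2"
    by (rule CMM_argmin_if_W2_argmin[OF assms(1,2) \<mu>1 assms(5) _ min assms(11)]) auto
  then have "\<eta>S = \<eta>2" using assms(6) by (auto simp: unique_arg_min_def)
  then have S: "W2_optimal_map \<mu>1 \<eta>2 S" using assms(7) by simp
  note T = assms(11)
  have [measurable]: "S \<in> borel_measurable borel" and Tm[measurable]: "T \<in> borel_measurable borel"
    using S T by (auto simp: W2_optimal_map_def)
  have "W2_squared \<mu>1 \<eta>2 \<le> transport_cost sq_dist (distr \<mu>1 borel (\<lambda>x. (x, T x)))"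
    unfolding W2_squared_def by (intro INF_lower W2_optimal_map_coupling[OF T])
  also have "\<dots> < \<infinity>"
    by (rule transport_cost_finite[OF W2_optimal_map_coupling(1)[OF T] \<mu>1 \<eta>2 assms(1)])
  finally have "AE x in \<mu>1. S x = T x"
    by (rule W2_optimal_map_unique[OF ac _ S T])
  then have "AE x in \<mu>1. (1 - t) *\<^sub>R x + t *\<^sub>R S x = (1 - t) *\<^sub>R x + t *\<^sub>R T x"
    by eventually_elim simp
  then have \<nu>: "\<nu> = distr \<mu>1 borel (\<lambda>x. (1 - t) *\<^sub>R x + t *\<^sub>R T x)"
    unfolding assms(8) by (intro distr_cong_AE) auto
  note ex = displacement_process_exists[OF p s Tm W2_optimal_map_push[OF T]]
  show ?thesis
    unfolding \<nu>
    using ex displacement_process_distr[OF ex assms(5) Tm]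
    by (intro conjI exI allI impI displacement_process_distr[OF _ assms(5) Tm])
qed

end
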